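(* Let $k$ be a field with $\mathrm{char}\,k\ne3$, let $M\supset k$ be an infinite field, and let $\mathbf a,\mathbf b\in M^3$ with $D_{\mathbf a}D_{\mathbf b}\neq0$. Assume that $f_3(\mathbf a;X)$ is irreducible over $M$ and $A_{\mathbf a}A_{\mathbf b}\ne0$. (1) If $A_{\mathbf a}^3B_{\mathbf b}^2-27A_{\mathbf b}^3D_{\mathbf a}=0$, then $\mathrm{Spl}_Mf_3(\mathbf a;X)=\mathrm{Spl}_Mf_3(\mathbf b;X)$. (2) If $A_{\mathbf a}^3B_{\mathbf b}^2-27A_{\mathbf b}^3D_{\mathbf a}\neq0$, then the following two conditions are equivalent: (i) $\mathrm{Spl}_Mf_3(\mathbf a;X)=\mathrm{Spl}_Mf_3(\mathbf b;X)$; (ii) the sextic polynomial $F_2(\mathbf a,\mathbf b;X)$ has a root in $M$.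
   Context: For $\mathbf a=(a_1,a_2,a_3)$ put $f_3(\mathbf a;X)=X^3-a_1X^2+a_2X-a_3$, $A_{\mathbf a}=a_1^2-3a_2$, $B_{\mathbf a}=2a_1^3-9a_1a_2+27a_3$, and let $D_{\mathbf a}=a_1^2a_2^2-4a_2^3-4a_1^3a_3+18a_1a_2a_3-27a_3^2$ be the discriminant of $f_3(\mathbf a;X)$; similarly for $\mathbf b$. Splitting fields $\mathrm{Spl}_M$ are taken in a fixed algebraic closure of $M$. Define $$F_2(\mathbf a,\mathbf b;X)=X^6-\frac{2A_{\mathbf a}A_{\mathbf b}}{D_{\mathbf a}}X^4+\frac{B_{\mathbf b}}{D_{\mathbf a}}X^3+\frac{A_{\mathbf a}^2A_{\mathbf b}^2}{D_{\mathbf a}^2}X^2-\frac{A_{\mathbf a}A_{\mathbf b}B_{\mathbf b}}{D_{\mathbf a}^2}X+\frac{A_{\mathbf b}^3D_{\mathbf a}-A_{\mathbf a}^3D_{\mathbf b}}{D_{\mathbf a}^3}.$$ *)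

theory Defs
  imports "HOL-Algebra.Generated_Fields" "HOL-Algebra.Algebraic_Closure_Type"
begin

fun f3 :: "'a \<times> 'a \<times> 'a \<Rightarrow> 'a::field poly" where
  "f3 (a1, a2, a3) = [:- a3, a2, - a1, 1:]"

text \<open>
  \<open>A3\<close> and \<open>B3\<close> come from completing the cube: with \<open>Y = 3 * X - a1\<close>,
  \<open>27 * f3 a = Y^3 - 3 * A3 a * Y - B3 a\<close>.
\<close>

fun A3 :: "'a \<times> 'a \<times> 'a \<Rightarrow> 'a::field" where
  "A3 (a1, a2, a3) = a1^2 - 3 * a2"

fun B3 :: "'a \<times> 'a \<times> 'a \<Rightarrow> 'a::field" where
  "B3 (a1, a2, a3) = 2 * a1^3 - 9 * a1 * a2 + 27 * a3"

text \<open>The discriminant of \<open>f3 (a1, a2, a3)\<close>.\<close>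

fun D3 :: "'a \<times> 'a \<times> 'a \<Rightarrow> 'a::field" where
  "D3 (a1, a2, a3) =
     a1^2 * a2^2 - 4 * a2^3 - 4 * a1^3 * a3 + 18 * a1 * a2 * a3 - 27 * a3^2"

text \<open>
  If \<open>x\<^sub>1, x\<^sub>2, x\<^sub>3\<close> are the roots of \<open>f3 a\<close> and \<open>y\<^sub>1, y\<^sub>2, y\<^sub>3\<close> those of \<open>f3 b\<close>, the roots of
  \<open>F2 a b\<close> are the six values of \<open>u\<^sub>2\<close>, one for each permutation \<open>\<pi>\<close>, in the Tschirnhausen
  transformation \<open>y\<^bsub>\<pi> i\<^esub> = u\<^sub>0 + u\<^sub>1 * x\<^sub>i + u\<^sub>2 * x\<^sub>i^2\<close> (\<open>i = 1, 2, 3\<close>).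
\<close>

definition F2 :: "'a \<times> 'a \<times> 'a \<Rightarrow> 'a \<times> 'a \<times> 'a \<Rightarrow> 'a::field poly" where
  "F2 a b =
     [: (A3 b ^ 3 * D3 a - A3 a ^ 3 * D3 b) / D3 a ^ 3,
        - (A3 a * A3 b * B3 b / D3 a ^ 2),
        A3 a ^ 2 * A3 b ^ 2 / D3 a ^ 2,
        B3 b / D3 a,
        - (2 * A3 a * A3 b / D3 a),
        0,
        1 :]"

text \<open>
  The splitting field of \<open>p\<close> inside the algebraic closure \<open>'a alg_closure\<close> of the field \<open>'a\<close>:
  the subfield generated by (the image of) \<open>'a\<close> and all roots of \<open>p\<close>. Two splitting fields are
  equal when they are the same subset of \<open>'a alg_closure\<close>.
\<close>

definition splitting_field :: "'a::field poly \<Rightarrow> 'a alg_closure set" where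
  "splitting_field p =
     generate_field ring_of_type_algebra
       (range to_ac \<union> {x. poly (map_poly to_ac p) x = 0})"

end

theory Submission
  imports Defs
begin

text \<open>
  In the variable \<open>3 * X - a\<^sub>1\<close> both cubics are depressed. For a root \<open>x\<close> of \<open>X ^ 3 - 3 * A * X - B\<close>, the
  element \<open>v * x + w * (x ^ 2 - 2 * A)\<close> is a root of \<open>Y ^ 3 - 3 * A' * Y - B'\<close>, where \<open>A'\<close> and \<open>B'\<close> are a
  binary quadratic and a binary cubic form in \<open>(v, w)\<close> over \<open>M\<close>. If \<open>(A', B')\<close> are the invariants of
  \<open>b\<close> for some \<open>v, w\<close> in \<open>M\<close>, the transformation has an explicit inverse and the splitting fields
  agree. Conversely, equal splitting fields yield such \<open>v, w\<close>: this only uses that a cubic with a root in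
  a quadratic extension of a field has a root in the field. Eliminating \<open>v\<close> from the two equations
  gives \<open>F2\<close> evaluated at \<open>3 * w\<close>, and \<open>v\<close> is a rational function of \<open>w\<close> unless \<open>3 * w\<close> is a multiple root
  of \<open>F2\<close>, which the condition of part (2) excludes, or \<open>B = 0\<close>, when \<open>f3 a\<close> is reducible. In
  part (1) the pair \<open>(v, w)\<close> is explicit.
\<close>

section \<open>Subfields of a field type\<close>

abbreviation is_subfield :: "'a::field set \<Rightarrow> bool" where
  "is_subfield K \<equiv> subfield K ring_of_type_algebra"

lemma ring_of_type_algebra_simps:
  "carrier (ring_of_type_algebra :: 'a::field ring) = UNIV"
  "\<one>\<^bsub>ring_of_type_algebra\<^esub> = (1 :: 'a)"
  "\<zero>\<^bsub>ring_of_type_algebra\<^esub> = (0 :: 'a)"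
  "x \<oplus>\<^bsub>ring_of_type_algebra\<^esub> y = (x + y :: 'a)"
  "x \<otimes>\<^bsub>ring_of_type_algebra\<^esub> y = (x * y :: 'a)"
  by (simp_all add: ring_of_type_algebra_def)

lemma a_inv_ring_of_type_algebra: "\<ominus>\<^bsub>ring_of_type_algebra\<^esub> x = - (x :: 'a::field)"
  using abelian_group.minus_equality[OF ring.is_abelian_group[OF ring_from_type_algebra], of "- x" x]
  by (simp add: ring_of_type_algebra_simps)

lemma m_inv_ring_of_type_algebra:
  "x \<noteq> 0 \<Longrightarrow> inv\<^bsub>ring_of_type_algebra\<^esub> x = inverse (x :: 'a::field)"
  using comm_monoid.comm_inv_char[OF cring.axioms(2)[OF cring_from_type_algebra],
      of x "inverse x"]
  by (simp add: ring_of_type_algebra_simps)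

lemma is_subfieldI:
  assumes "1 \<in> K" "\<And>x. x \<in> K \<Longrightarrow> - x \<in> K"
    and "\<And>x y. x \<in> K \<Longrightarrow> y \<in> K \<Longrightarrow> x + y \<in> K"
    and "\<And>x y. x \<in> K \<Longrightarrow> y \<in> K \<Longrightarrow> x * y \<in> K"
    and "\<And>x. x \<in> K \<Longrightarrow> x \<noteq> 0 \<Longrightarrow> inverse x \<in> K"
  shows "is_subfield (K :: 'a::field set)"
  by (intro field.subfieldI'[OF field_from_type_algebra] ring.subringI[OF ring_from_type_algebra])
    (auto simp: ring_of_type_algebra_simps a_inv_ring_of_type_algebra
      m_inv_ring_of_type_algebra assms)

lemma subfield_1: "is_subfield K \<Longrightarrow> 1 \<in> K"
  using subringE(3)[OF subfieldE(1)] by (force simp: ring_of_type_algebra_simps)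

lemma subfield_0: "is_subfield K \<Longrightarrow> 0 \<in> K"
  using subringE(2)[OF subfieldE(1)] by (force simp: ring_of_type_algebra_simps)

lemma subfield_uminus: "is_subfield K \<Longrightarrow> x \<in> K \<Longrightarrow> - x \<in> K"
  using subringE(5)[OF subfieldE(1), of K ring_of_type_algebra x]
  by (simp add: a_inv_ring_of_type_algebra)

lemma subfield_add: "is_subfield K \<Longrightarrow> x \<in> K \<Longrightarrow> y \<in> K \<Longrightarrow> x + y \<in> K"
  using subringE(7)[OF subfieldE(1), of K ring_of_type_algebra x y]
  by (simp add: ring_of_type_algebra_simps)

lemma subfield_mult: "is_subfield K \<Longrightarrow> x \<in> K \<Longrightarrow> y \<in> K \<Longrightarrow> x * y \<in> K"
  using subringE(6)[OF subfieldE(1), of K ring_of_type_algebra x y]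
  by (simp add: ring_of_type_algebra_simps)

lemma subfield_inverse: "is_subfield K \<Longrightarrow> x \<in> K \<Longrightarrow> inverse x \<in> K"
  using ring.subfield_m_inv(1)[OF ring_from_type_algebra, of K x] subfield_0[of K]
  by (cases "x = 0") (auto simp: m_inv_ring_of_type_algebra ring_of_type_algebra_simps)

lemma subfield_diff: "is_subfield K \<Longrightarrow> x \<in> K \<Longrightarrow> y \<in> K \<Longrightarrow> x - y \<in> K"
  using subfield_add[of K x "- y"] subfield_uminus[of K y] by simp

lemma subfield_divide: "is_subfield K \<Longrightarrow> x \<in> K \<Longrightarrow> y \<in> K \<Longrightarrow> x / y \<in> K"
  using subfield_mult[of K x "inverse y"] subfield_inverse[of K y] by (simp add: divide_inverse)

lemma subfield_power: "is_subfield K \<Longrightarrow> x \<in> K \<Longrightarrow> x ^ n \<in> K"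
  by (induction n) (auto intro: subfield_1 subfield_mult)

lemma subfield_numeral: "is_subfield K \<Longrightarrow> numeral n \<in> K"
proof -
  assume K: "is_subfield K"
  have "of_nat k \<in> K" for k
    by (induction k) (auto intro: K subfield_0 subfield_1 subfield_add)
  from this[of "numeral n"] show ?thesis by simp
qed

lemma subfield_closed:
  assumes "is_subfield K"
  shows "0 \<in> K" "1 \<in> K"
    and "\<And>x. x \<in> K \<Longrightarrow> - x \<in> K"
    and "\<And>x y. x \<in> K \<Longrightarrow> y \<in> K \<Longrightarrow> x + y \<in> K"
    and "\<And>x y. x \<in> K \<Longrightarrow> y \<in> K \<Longrightarrow> x * y \<in> K"
    and "\<And>x. x \<in> K \<Longrightarrow> inverse x \<in> K"
    and "\<And>x y. x \<in> K \<Longrightarrow> y \<in> K \<Longrightarrow> x - y \<in> K"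
    and "\<And>x y. x \<in> K \<Longrightarrow> y \<in> K \<Longrightarrow> x / y \<in> K"
    and "\<And>x n. x \<in> K \<Longrightarrow> x ^ n \<in> K"
    and "\<And>n. numeral n \<in> K"
  by (fact subfield_0[OF assms] subfield_1[OF assms] subfield_uminus[OF assms]
      subfield_add[OF assms] subfield_mult[OF assms] subfield_inverse[OF assms]
      subfield_diff[OF assms] subfield_divide[OF assms] subfield_power[OF assms]
      subfield_numeral[OF assms])+

text \<open>A domain whose elements are algebraic over a subfield is itself a field: divide by the
  lowest non-vanishing coefficient.\<close>

lemma is_subfield_of_cubic_elements:
  assumes K: "is_subfield K" and KL: "K \<subseteq> L"
    and neg: "\<And>x. x \<in> L \<Longrightarrow> - x \<in> L"
    and add: "\<And>x y. x \<in> L \<Longrightarrow> y \<in> L \<Longrightarrow> x + y \<in> L"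
    and mult: "\<And>x y. x \<in> L \<Longrightarrow> y \<in> L \<Longrightarrow> x * y \<in> L"
    and cubic: "\<And>x. x \<in> L \<Longrightarrow> \<exists>e\<in>K. \<exists>f\<in>K. \<exists>g\<in>K. x ^ 3 + e * x ^ 2 + f * x + g = 0"
  shows "is_subfield L"
proof (rule is_subfieldI)
  fix x assume x: "x \<in> L" "x \<noteq> 0"
  then obtain e f g where efg: "e \<in> K" "f \<in> K" "g \<in> K" and
    eq: "x ^ 3 + e * x ^ 2 + f * x + g = 0" using cubic by blast
  have *: "inverse x = - (y / d)" if "x * y + d = 0" "d \<noteq> 0" for y d
  proof -
    have "x * y = - d" using that(1) by (simp add: add_eq_0_iff2)
    then have "x * (- (y / d)) = 1" using that(2) by simp
    then show ?thesis by (rule inverse_unique)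
  qed
  have **: "inverse x \<in> L" if "x * y + d = 0" "d \<noteq> 0" "y \<in> L" "d \<in> K" for y d
    using *[OF that(1,2)] neg mult[OF that(3), of "inverse d"] subfield_inverse[OF K that(4)] KL
    by (auto simp: divide_inverse)
  have L: "e \<in> L" "f \<in> L" "x ^ 2 \<in> L" "1 \<in> L"
    using efg KL mult[OF x(1,1)] subfield_1[OF K] by (auto simp: power2_eq_square)
  consider "g \<noteq> 0" | "g = 0" "f \<noteq> 0" | "g = 0" "f = 0" by blast
  then show "inverse x \<in> L"
  proof cases
    case 1
    have "x * (x ^ 2 + e * x + f) + g = 0"
      using eq by (simp add: algebra_simps power2_eq_square power3_eq_cube)
    then show ?thesis by (rule **) (use 1 efg L x add mult in auto)
  next
    case 2
    have "x * (x * (x + e) + f) = 0"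
      using eq 2 by (simp add: algebra_simps power2_eq_square power3_eq_cube)
    then have "x * (x + e) + f = 0" using x by simp
    then show ?thesis by (rule **) (use 2 efg L x add mult in auto)
  next
    case 3
    have "x * (x * (x * 1 + e)) = 0"
      using eq 3 by (simp add: algebra_simps power2_eq_square power3_eq_cube)
    then have "x * 1 + e = 0" using x by simp
    moreover from this have "e \<noteq> 0" using x by auto
    ultimately show ?thesis by (rule **) (use efg L in auto)
  qed
qed (use assms subfield_1[OF K] in auto)

text \<open>Each \<open>p + q * t\<close> satisfies a quadratic equation over \<open>K\<close> with
  its trace and norm as coefficients, so the previous lemma supplies inverses. The element
  \<open>t\<close> may already lie in \<open>K\<close>.\<close>

lemma is_subfield_quadratic_extension:
  assumes K: "is_subfield K" and rs: "r \<in> K" "s \<in> K" and t: "t ^ 2 = r * t + s"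
  shows "is_subfield {p + q * t | p q. p \<in> K \<and> q \<in> K}" (is "is_subfield ?L")
proof (rule is_subfield_of_cubic_elements[OF K])
  note closed = subfield_closed[OF K]
  show "K \<subseteq> ?L"
  proof
    fix x assume "x \<in> K"
    then have "x = x + 0 * t \<and> x \<in> K \<and> 0 \<in> K" using closed(1) by auto
    then show "x \<in> ?L" by blast
  qed
  fix x assume "x \<in> ?L"
  then obtain p q where pq: "p \<in> K" "q \<in> K" "x = p + q * t" by blast
  have "- x = - p + (- q) * t \<and> - p \<in> K \<and> - q \<in> K" using pq closed by simp
  then show "- x \<in> ?L" by blast
  have "x ^ 2 + (- (2 * p + q * r)) * x + (p ^ 2 + p * q * r - q ^ 2 * s) =
      q ^ 2 * (t ^ 2 - (r * t + s))"
    unfolding pq by (simp add: algebra_simps power2_eq_square)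
  then have "x * (x ^ 2 + (- (2 * p + q * r)) * x + (p ^ 2 + p * q * r - q ^ 2 * s)) = 0"
    using t by simp
  then have "x ^ 3 + (- (2 * p + q * r)) * x ^ 2 + (p ^ 2 + p * q * r - q ^ 2 * s) * x + 0 = 0"
    by (simp add: algebra_simps power2_eq_square power3_eq_cube)
  moreover have "- (2 * p + q * r) \<in> K" "p ^ 2 + p * q * r - q ^ 2 * s \<in> K"
    using pq rs by (auto intro!: closed)
  ultimately show "\<exists>e\<in>K. \<exists>f\<in>K. \<exists>g\<in>K. x ^ 3 + e * x ^ 2 + f * x + g = 0"
    using closed(1) by blast
  fix y assume "y \<in> ?L"
  then obtain p' q' where pq': "p' \<in> K" "q' \<in> K" "y = p' + q' * t" by blast
  have "x + y = (p + p') + (q + q') * t \<and> p + p' \<in> K \<and> q + q' \<in> K"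
    using pq pq' closed by (simp add: algebra_simps)
  then show "x + y \<in> ?L" by blast
  have "x * y = p * p' + (p * q' + q * p') * t + q * q' * t ^ 2"
    unfolding pq(3) pq'(3) by (simp add: algebra_simps power2_eq_square)
  also have "\<dots> = (p * p' + q * q' * s) + (p * q' + q * p' + q * q' * r) * t"
    unfolding t by (simp add: algebra_simps)
  finally have "x * y = \<dots> \<and> p * p' + q * q' * s \<in> K \<and> p * q' + q * p' + q * q' * r \<in> K"
    using pq pq' rs by (auto intro!: closed)
  then show "x * y \<in> ?L" by blast
qed

section \<open>Transformations of depressed cubics\<close>

lemma twenty_seven_nonzero: "(3 :: 'a::field) \<noteq> 0 \<Longrightarrow> (27 :: 'a) \<noteq> 0"
proof -
  have "(27 :: 'a) = 3 * (3 * 3)" by simp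
  then show "(3 :: 'a) \<noteq> 0 \<Longrightarrow> (27 :: 'a) \<noteq> 0" by (metis mult_eq_0_iff)
qed

text \<open>If \<open>x\<close> runs through the roots of \<open>X ^ 3 - 3 * A * X - B\<close>, then \<open>v * x + w * (x ^ 2 - 2 * A)\<close>,
  the general trace-free element in the span of \<open>1, x, x ^ 2\<close>, runs through the roots of
  \<open>Y ^ 3 - 3 * tschirn_A A B v w * Y - tschirn_B A B v w\<close>.\<close>

definition tschirn_A :: "'a::field \<Rightarrow> 'a \<Rightarrow> 'a \<Rightarrow> 'a \<Rightarrow> 'a" where
  "tschirn_A A B v w = A * v ^ 2 + B * v * w + A ^ 2 * w ^ 2"

definition tschirn_B :: "'a::field \<Rightarrow> 'a \<Rightarrow> 'a \<Rightarrow> 'a \<Rightarrow> 'a" where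
  "tschirn_B A B v w = B * v ^ 3 + 6 * A ^ 2 * v ^ 2 * w + 3 * A * B * v * w ^ 2
    + (B ^ 2 - 2 * A ^ 3) * w ^ 3"

lemma transform_root:
  fixes x :: "'a::field"
  assumes x: "x ^ 3 = 3 * A * x + B" and y: "y = v * x + w * (x ^ 2 - 2 * A)"
  shows "y ^ 3 = 3 * tschirn_A A B v w * y + tschirn_B A B v w"
proof -
  have "y ^ 3 - (3 * tschirn_A A B v w * y + tschirn_B A B v w) =
      (w ^ 3 * x ^ 3 + 3 * w ^ 2 * v * x ^ 2 + (3 * w * v ^ 2 - 3 * A * w ^ 3) * x
        + (v ^ 3 - 3 * A * v * w ^ 2 + B * w ^ 3)) * (x ^ 3 - (3 * A * x + B))"
    unfolding y tschirn_A_def tschirn_B_def by (simp add: algebra_simps eval_nat_numeral)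
  then show ?thesis using x by simp
qed

text \<open>The syzygy between the covariants \<open>tschirn_A\<close>, \<open>tschirn_B\<close> and \<open>d\<close> of the cubic form \<open>d\<close>, with
  \<open>t = (B * d - tschirn_B A B v w) / 2\<close> in place of \<open>tschirn_B\<close> so that it holds in characteristic 2.\<close>

lemma tschirn_syzygy:
  assumes d: "d = v ^ 3 - 3 * A * v * w ^ 2 - B * w ^ 3"
    and t: "t = (A ^ 3 - B ^ 2) * w ^ 3 - 3 * A ^ 2 * v ^ 2 * w - 3 * A * B * v * w ^ 2"
  shows "tschirn_B A B v w = B * d - 2 * t"
    and "tschirn_A A B v w ^ 3 = t ^ 2 - B * d * t + A ^ 3 * d ^ 2"
  unfolding d t tschirn_A_def tschirn_B_def by (simp_all add: algebra_simps eval_nat_numeral)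

text \<open>\<open>d\<close> is the determinant of the passage from \<open>1, x, x ^ 2\<close> to
  \<open>1, y, y ^ 2\<close> for \<open>y = v * x + w * (x ^ 2 - 2 * A)\<close>, hence its
  square.\<close>

lemma tschirn_discriminant:
  assumes d: "d = v ^ 3 - 3 * A * v * w ^ 2 - B * w ^ 3"
  shows "4 * tschirn_A A B v w ^ 3 - tschirn_B A B v w ^ 2 = (4 * A ^ 3 - B ^ 2) * d ^ 2"
proof -
  define t where "t = (A ^ 3 - B ^ 2) * w ^ 3 - 3 * A ^ 2 * v ^ 2 * w - 3 * A * B * v * w ^ 2"
  show ?thesis
    unfolding tschirn_syzygy[OF d t_def] by (simp add: algebra_simps power2_eq_square)
qed

lemma tschirn_A_divide: "tschirn_A A B (v / d) (w / d) = tschirn_A A B v w / d ^ 2"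
  unfolding tschirn_A_def by (simp add: power_divide power2_eq_square add_divide_distrib)

lemma tschirn_B_divide: "tschirn_B A B (v / d) (w / d) = tschirn_B A B v w / d ^ 3"
  unfolding tschirn_B_def by (simp add: power_divide power2_eq_square power3_eq_cube add_divide_distrib)

text \<open>Transforming \<open>y\<close> with \<open>v ^ 2 - A * w ^ 2\<close> and
  \<open>- w\<close> gives \<open>d * x\<close>, and scaling \<open>x\<close> by \<open>d\<close>
  scales the invariants by \<open>d ^ 2\<close> and \<open>d ^ 3\<close>.\<close>

lemma tschirn_inverse:
  assumes d: "d = v ^ 3 - 3 * A * v * w ^ 2 - B * w ^ 3"
  shows "tschirn_A (tschirn_A A B v w) (tschirn_B A B v w) (v ^ 2 - A * w ^ 2) (- w) = A * d ^ 2"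
    and "tschirn_B (tschirn_A A B v w) (tschirn_B A B v w) (v ^ 2 - A * w ^ 2) (- w) = B * d ^ 3"
proof -
  \<comment> \<open>Rewriting by \<open>u2\<close> and \<open>Cu\<close> lets powers of
    \<open>d\<close> split off without a full expansion in \<open>v\<close> and
    \<open>w\<close>.\<close>
  define Q C u where "Q = tschirn_A A B v w" and "C = tschirn_B A B v w" and "u = v ^ 2 - A * w ^ 2"
  define r where "r = B * v ^ 2 + 4 * A ^ 2 * v * w + A * B * w ^ 2"
  have u2: "u ^ 2 = v * d + Q * w ^ 2"
    unfolding u_def Q_def d tschirn_A_def by (simp add: algebra_simps eval_nat_numeral)
  have Cu: "C * u = d * r + 2 * Q ^ 2 * w"
    unfolding C_def u_def Q_def r_def d tschirn_A_def tschirn_B_def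
    by (simp add: algebra_simps eval_nat_numeral)
  have Qv: "Q * v - r * w = A * d"
    unfolding Q_def r_def d tschirn_A_def by (simp add: algebra_simps eval_nat_numeral)
  have "tschirn_A Q C u (- w) = Q * u ^ 2 - (C * u) * w + Q ^ 2 * w ^ 2"
    unfolding tschirn_A_def[of Q] by simp
  also have "\<dots> = (Q * v - r * w) * d"
    unfolding u2 Cu by (simp add: algebra_simps power2_eq_square)
  also have "\<dots> = A * d ^ 2" unfolding Qv by (simp add: power2_eq_square)
  finally show "tschirn_A (tschirn_A A B v w) (tschirn_B A B v w) (v ^ 2 - A * w ^ 2) (- w) = A * d ^ 2"
    unfolding Q_def C_def u_def .
  have rest: "r * (v * d + 4 * Q * w ^ 2) - 4 * Q ^ 2 * v * w + (4 * A ^ 3 - B ^ 2) * d * w ^ 3 = B * d ^ 2"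
  proof -
    have "r * v + (4 * A ^ 3 - B ^ 2) * w ^ 3 - 4 * A * Q * w = B * d"
      unfolding r_def Q_def d tschirn_A_def by (simp add: algebra_simps eval_nat_numeral)
    then have "(r * v + (4 * A ^ 3 - B ^ 2) * w ^ 3 - 4 * A * Q * w) * d = B * d ^ 2"
      by (simp add: power2_eq_square)
    moreover have "r * (v * d + 4 * Q * w ^ 2) - 4 * Q ^ 2 * v * w + (4 * A ^ 3 - B ^ 2) * d * w ^ 3
        = (r * v + (4 * A ^ 3 - B ^ 2) * w ^ 3 - 4 * A * Q * w) * d
          - 4 * Q * w * (Q * v - r * w - A * d)"
      by (simp add: algebra_simps power2_eq_square)
    ultimately show ?thesis unfolding Qv by simp
  qed
  have "tschirn_B Q C u (- w) = (C * u) * u ^ 2 - 6 * Q ^ 2 * u ^ 2 * w + 3 * Q * (C * u) * w ^ 2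
      + (4 * Q ^ 3 - C ^ 2) * w ^ 3 - 2 * Q ^ 3 * w ^ 3"
    unfolding tschirn_B_def[of Q] by (simp add: algebra_simps power2_eq_square power3_eq_cube)
  also have "4 * Q ^ 3 - C ^ 2 = (4 * A ^ 3 - B ^ 2) * d ^ 2"
    unfolding Q_def C_def by (rule tschirn_discriminant[OF d])
  also have "(C * u) * u ^ 2 - 6 * Q ^ 2 * u ^ 2 * w + 3 * Q * (C * u) * w ^ 2
      + (4 * A ^ 3 - B ^ 2) * d ^ 2 * w ^ 3 - 2 * Q ^ 3 * w ^ 3
      = d * (r * (v * d + 4 * Q * w ^ 2) - 4 * Q ^ 2 * v * w + (4 * A ^ 3 - B ^ 2) * d * w ^ 3)"
    unfolding Cu u2 by (simp add: algebra_simps power2_eq_square power3_eq_cube)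
  also have "\<dots> = B * d ^ 3" unfolding rest by (simp add: power2_eq_square power3_eq_cube)
  finally show "tschirn_B (tschirn_A A B v w) (tschirn_B A B v w) (v ^ 2 - A * w ^ 2) (- w) = B * d ^ 3"
    unfolding Q_def C_def u_def .
qed

text \<open>Cramer's rule: \<open>y\<close> and \<open>y ^ 2 - 2 * tschirn_A A B v w\<close> have
  coordinates \<open>(v, w)\<close> and
  \<open>(2 * A * v * w + B * w ^ 2, v ^ 2 - A * w ^ 2)\<close> with respect to \<open>x\<close> and
  \<open>x ^ 2 - 2 * A\<close>.\<close>

lemma transform_inverse:
  fixes x :: "'a::field"
  assumes x: "x ^ 3 = 3 * A * x + B" and y: "y = v * x + w * (x ^ 2 - 2 * A)"
  shows "(v ^ 2 - A * w ^ 2) * y - w * (y ^ 2 - 2 * tschirn_A A B v w)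
    = (v ^ 3 - 3 * A * v * w ^ 2 - B * w ^ 3) * x"
proof -
  have "(v ^ 2 - A * w ^ 2) * y - w * (y ^ 2 - 2 * tschirn_A A B v w)
      - (v ^ 3 - 3 * A * v * w ^ 2 - B * w ^ 3) * x
      = - (w ^ 3 * x + 2 * v * w ^ 2) * (x ^ 3 - (3 * A * x + B))"
    unfolding y tschirn_A_def by (simp add: algebra_simps eval_nat_numeral)
  then show ?thesis using x by simp
qed

section \<open>Cubic and quadratic extensions of a subfield\<close>

lemma is_subfield_cubic_extension:
  assumes K: "is_subfield K" and AB: "A \<in> K" "B \<in> K" and x: "x ^ 3 = 3 * A * x + B"
  shows "is_subfield {c + v * x + w * (x ^ 2 - 2 * A) | c v w. c \<in> K \<and> v \<in> K \<and> w \<in> K}"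
    (is "is_subfield ?L")
proof (rule is_subfield_of_cubic_elements[OF K])
  note closed = subfield_closed[OF K]
  show "K \<subseteq> ?L"
  proof
    fix z assume "z \<in> K"
    then have "z = z + 0 * x + 0 * (x ^ 2 - 2 * A) \<and> z \<in> K \<and> 0 \<in> K \<and> 0 \<in> K"
      using closed(1) by auto
    then show "z \<in> ?L" by blast
  qed
  fix z assume "z \<in> ?L"
  then obtain c v w where z: "c \<in> K" "v \<in> K" "w \<in> K" "z = c + v * x + w * (x ^ 2 - 2 * A)" by blast
  have "- z = - c + (- v) * x + (- w) * (x ^ 2 - 2 * A) \<and> - c \<in> K \<and> - v \<in> K \<and> - w \<in> K"
    using z closed(3) by (simp add: algebra_simps)
  then show "- z \<in> ?L" by blast
  \<comment> \<open>Without \<open>c\<close> the element is trace-free, so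
    \<open>transform_root\<close> supplies the cubic equation that yields inverses.\<close>
  have "(z - c) ^ 3 = 3 * tschirn_A A B v w * (z - c) + tschirn_B A B v w"
    using transform_root[OF x, of "z - c" v w] z by simp
  then have "z ^ 3 + (- 3 * c) * z ^ 2 + (3 * c ^ 2 - 3 * tschirn_A A B v w) * z
      + (3 * tschirn_A A B v w * c - c ^ 3 - tschirn_B A B v w) = 0"
    by (simp add: algebra_simps power2_eq_square power3_eq_cube)
  moreover have "- 3 * c \<in> K" "3 * c ^ 2 - 3 * tschirn_A A B v w \<in> K"
    "3 * tschirn_A A B v w * c - c ^ 3 - tschirn_B A B v w \<in> K"
    using z AB unfolding tschirn_A_def tschirn_B_def by (auto intro!: closed)
  ultimately show "\<exists>e\<in>K. \<exists>f\<in>K. \<exists>g\<in>K. z ^ 3 + e * z ^ 2 + f * z + g = 0"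
    by blast
  fix z' assume "z' \<in> ?L"
  then obtain c' v' w' where z': "c' \<in> K" "v' \<in> K" "w' \<in> K"
    "z' = c' + v' * x + w' * (x ^ 2 - 2 * A)" by blast
  have "z + z' = (c + c') + (v + v') * x + (w + w') * (x ^ 2 - 2 * A)
      \<and> c + c' \<in> K \<and> v + v' \<in> K \<and> w + w' \<in> K"
    unfolding z(4) z'(4) using z(1-3) z'(1-3) closed(4) by (simp add: algebra_simps)
  then show "z + z' \<in> ?L" by blast
  have "z * z' - (c * c' + 2 * A * v * v' + B * (v * w' + w * v') + 2 * A ^ 2 * w * w'
      + (c * v' + v * c' + A * (v * w' + w * v') + B * w * w') * x
      + (c * w' + w * c' + v * v' - A * w * w') * (x ^ 2 - 2 * A))
      = (v * w' + w * v' + w * w' * x) * (x ^ 3 - (3 * A * x + B))"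
    unfolding z z' by (simp add: algebra_simps eval_nat_numeral)
  then have "z * z' = c * c' + 2 * A * v * v' + B * (v * w' + w * v') + 2 * A ^ 2 * w * w'
      + (c * v' + v * c' + A * (v * w' + w * v') + B * w * w') * x
      + (c * w' + w * c' + v * v' - A * w * w') * (x ^ 2 - 2 * A)"
    using x by simp
  moreover have
    "c * c' + 2 * A * v * v' + B * (v * w' + w * v') + 2 * A ^ 2 * w * w' \<in> K"
    "c * v' + v * c' + A * (v * w' + w * v') + B * w * w' \<in> K"
    "c * w' + w * c' + v * v' - A * w * w' \<in> K"
    using z z' AB by (auto intro!: closed)
  ultimately show "z * z' \<in> ?L" by blast
qed

text \<open>A quadratic polynomial over \<open>K\<close> with a root in common with a cubic one either has a root in \<open>K\<close>
  or divides the cubic, leaving a linear factor.\<close>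

lemma cubic_root_in_quadratic_extension:
  assumes K: "is_subfield K" and "A \<in> K" "B \<in> K" "r \<in> K" "s \<in> K"
    and z: "z ^ 3 = 3 * A * z + B" and t: "t ^ 2 = r * t + s"
    and "z \<in> {p + q * t | p q. p \<in> K \<and> q \<in> K}"
  shows "\<exists>c\<in>K. c ^ 3 = 3 * A * c + B"
proof (cases "z \<in> K")
  case False
  note closed = subfield_closed[OF K]
  obtain p q where pq: "p \<in> K" "q \<in> K" "z = p + q * t" using assms by blast
  \<comment> \<open>\<open>m\<close> and \<open>- n\<close> are the trace and norm of
    \<open>p + q * t\<close>.\<close>
  define m n where "m = 2 * p + q * r" and "n = q ^ 2 * s - p ^ 2 - p * q * r"
  have mn: "m \<in> K" "n \<in> K" using assms pq unfolding m_def n_def by (auto intro!: closed)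
  have "z ^ 2 - (m * z + n) = q ^ 2 * (t ^ 2 - (r * t + s))"
    unfolding pq m_def n_def by (simp add: algebra_simps power2_eq_square)
  then have z2: "z ^ 2 = m * z + n" using t by simp
  have "z ^ 3 = z * z ^ 2" by (simp add: power2_eq_square power3_eq_cube)
  also have "\<dots> = m * z ^ 2 + n * z"
    by (subst z2) (simp add: algebra_simps power2_eq_square)
  finally have lin: "(m ^ 2 + n - 3 * A) * z = B - m * n"
    unfolding z z2 by (simp add: algebra_simps power2_eq_square)
  have 0: "m ^ 2 + n - 3 * A = 0"
  proof (rule ccontr)
    assume "m ^ 2 + n - 3 * A \<noteq> 0"
    then have "z = (B - m * n) / (m ^ 2 + n - 3 * A)" using lin by (simp add: field_simps)
    also have "\<dots> \<in> K" using assms mn by (intro closed)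
    finally show False using False by simp
  qed
  \<comment> \<open>The quadratic divides the cubic,
    \<open>X ^ 3 - 3 * A * X - B = (X ^ 2 - m * X - n) * (X + m)\<close>, whence the root
    \<open>- m\<close>.\<close>
  then have "3 * A = m ^ 2 + n" by simp
  moreover have "B = m * n" using lin unfolding 0 by simp
  ultimately have "(- m) ^ 3 = 3 * A * (- m) + B"
    by (simp only:) (simp add: algebra_simps power2_eq_square power3_eq_cube)
  then show ?thesis using mn closed(3) by blast
qed (use z in blast)

text \<open>A relation with \<open>r \<noteq> 0\<close> makes \<open>z\<close> quadratic over
  \<open>K\<close>, and the previous lemma with \<open>t = z\<close> yields a root in
  \<open>K\<close>.\<close>

lemma irreducible_cubic_root_independent:
  assumes K: "is_subfield K" and AB: "A \<in> K" "B \<in> K"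
    and no_root: "\<And>c. c \<in> K \<Longrightarrow> c ^ 3 \<noteq> 3 * A * c + B"
    and z: "z ^ 3 = 3 * A * z + B"
    and pqr: "p \<in> K" "q \<in> K" "r \<in> K" and eq: "p + q * z + r * z ^ 2 = 0"
  shows "p = 0 \<and> q = 0 \<and> r = 0"
proof -
  note closed = subfield_closed[OF K]
  have "r = 0"
  proof (rule ccontr)
    assume "r \<noteq> 0"
    have "r * z ^ 2 = (p + q * z + r * z ^ 2) - q * z - p" by simp
    then have "r * z ^ 2 = - (q * z) - p" using eq by simp
    then have "z ^ 2 = (- (q * z) - p) / r" using \<open>r \<noteq> 0\<close> by (simp add: eq_divide_eq mult.commute)
    then have z2: "z ^ 2 = (- (q / r)) * z + (- (p / r))" by (simp add: diff_divide_distrib)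
    have "z = 0 + 1 * z \<and> 0 \<in> K \<and> 1 \<in> K" using closed(1,2) by simp
    then have mem: "z \<in> {p + q * z | p q. p \<in> K \<and> q \<in> K}" by blast
    have "- (q / r) \<in> K" "- (p / r) \<in> K" using pqr by (auto intro!: closed)
    from cubic_root_in_quadratic_extension[OF K AB this z z2 mem] no_root
    show False by blast
  qed
  moreover have "q = 0"
  proof (rule ccontr)
    assume "q \<noteq> 0"
    then have "z = - p / q" using eq \<open>r = 0\<close> by (simp add: field_simps add_eq_0_iff)
    also have "\<dots> \<in> K" using pqr by (auto intro!: closed)
    finally show False using no_root z by blast
  qed
  ultimately show ?thesis using eq by simp
qed

section \<open>Splitting fields of cubics\<close>

text \<open>The cubic \<open>Y ^ 3 - 3 * A * Y - B\<close> has discriminant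
  \<open>27 * (4 * A ^ 3 - B ^ 2)\<close>. Its roots are \<open>3 * x - a1\<close>, so this is
  \<open>3 ^ 6 * D3 a\<close>.\<close>

lemma A3_B3_D3: "4 * A3 a ^ 3 = B3 a ^ 2 + 27 * D3 a"
  by (cases a) (simp add: algebra_simps eval_nat_numeral)

lemma poly_f3_depressed:
  "(3 * x - to_ac a1) ^ 3 - (3 * to_ac (A3 (a1, a2, a3)) * (3 * x - to_ac a1) + to_ac (B3 (a1, a2, a3)))
    = 27 * poly (map_poly to_ac (f3 (a1, a2, a3))) x"
  by (simp add: map_poly_pCons algebra_simps eval_nat_numeral)

abbreviation depressed_roots :: "'m::field \<times> 'm \<times> 'm \<Rightarrow> 'm alg_closure set" where
  "depressed_roots a \<equiv> {x. x ^ 3 = 3 * to_ac (A3 a) * x + to_ac (B3 a)}"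

lemma is_subfield_range_to_ac: "is_subfield (range to_ac)"
proof (rule is_subfieldI)
  show "1 \<in> range to_ac" by (metis rangeI to_ac_1)
  fix x y :: "'a alg_closure" assume "x \<in> range to_ac"
  then obtain x' where x: "x = to_ac x'" by blast
  show "- x \<in> range to_ac" "inverse x \<in> range to_ac"
    unfolding x by (simp_all flip: to_ac_minus to_ac_inverse)
  assume "y \<in> range to_ac"
  then obtain y' where y: "y = to_ac y'" by blast
  show "x + y \<in> range to_ac" "x * y \<in> range to_ac"
    unfolding x y by (simp_all flip: to_ac_add to_ac_mult)
qed

lemma three_alg_closure_nonzero: "(3 :: 'm::field) \<noteq> 0 \<Longrightarrow> (3 :: 'm alg_closure) \<noteq> 0"
  using to_ac_eq_0_iff[of "3 :: 'm"] by simp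

text \<open>The substitution \<open>3 * x - a1\<close> is defined over the ground field and
  invertible there since \<open>3 \<noteq> 0\<close>.\<close>

lemma splitting_field_f3:
  fixes a :: "'m::field \<times> 'm \<times> 'm"
  assumes three: "(3 :: 'm) \<noteq> 0"
  shows "splitting_field (f3 a) =
    generate_field ring_of_type_algebra (range to_ac \<union> depressed_roots a)"
    (is "_ = ?R")
proof -
  obtain a1 a2 a3 where a: "a = (a1, a2, a3)" by (cases a)
  note three_ac = three_alg_closure_nonzero[OF three]
  let ?S = "{x. poly (map_poly to_ac (f3 a)) x = 0}"
  have root: "x \<in> ?S \<longleftrightarrow> 3 * x - to_ac a1 \<in> depressed_roots a" for x
    using twenty_seven_nonzero[OF three_ac] poly_f3_depressed[of x a1 a2 a3]
    unfolding a mem_Collect_eq eq_iff_diff_eq_0[of "(3 * x - to_ac a1) ^ 3"] by simp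
  have U: "H \<subseteq> carrier (ring_of_type_algebra :: 'm alg_closure ring)" for H
    by (simp add: ring_of_type_algebra_simps)
  note sub = field.generate_field_is_subfield[OF field_from_type_algebra U]
  show ?thesis unfolding splitting_field_def
  proof (rule antisym;
      rule field.generate_field_min_subfield1[OF field_from_type_algebra U sub]; rule Un_least)
    show "range to_ac \<subseteq> ?R"
      and "range to_ac \<subseteq> generate_field ring_of_type_algebra (range to_ac \<union> ?S)"
      by (auto intro: generate_field.incl)
    have r: "to_ac a1 \<in> generate_field ring_of_type_algebra (range to_ac \<union> H)" for H
      by (auto intro: generate_field.incl)
    show "?S \<subseteq> ?R"
    proof
      fix x assume "x \<in> ?S"
      then have "3 * x - to_ac a1 \<in> ?R" using root by (auto intro: generate_field.incl)
      then have "((3 * x - to_ac a1) + to_ac a1) / 3 \<in> ?R"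
        using r by (intro subfield_divide[OF sub] subfield_add[OF sub] subfield_numeral[OF sub])
      then show "x \<in> ?R" using three_ac by simp
    qed
    show "depressed_roots a \<subseteq> generate_field ring_of_type_algebra (range to_ac \<union> ?S)"
      (is "_ \<subseteq> ?L")
    proof
      fix x assume "x \<in> depressed_roots a"
      then have "(x + to_ac a1) / 3 \<in> ?S" unfolding root using three_ac by simp
      then have "(x + to_ac a1) / 3 \<in> ?L" by (intro generate_field.incl) simp
      then have "3 * ((x + to_ac a1) / 3) - to_ac a1 \<in> ?L"
        using r by (intro subfield_diff[OF sub] subfield_mult[OF sub] subfield_numeral[OF sub])
      then show "x \<in> ?L" using three_ac by simp
    qed
  qed
qed

lemma is_subfield_splitting_field: "is_subfield (splitting_field (f3 a))"
  unfolding splitting_field_def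
  by (rule field.generate_field_is_subfield[OF field_from_type_algebra])
    (simp add: ring_of_type_algebra_simps)

lemma depressed_roots_subset_splitting_field:
  fixes a :: "'m::field \<times> 'm \<times> 'm"
  assumes "(3 :: 'm) \<noteq> 0"
  shows "depressed_roots a \<subseteq> splitting_field (f3 a)"
  unfolding splitting_field_f3[OF assms] by (auto intro: generate_field.incl)

lemma to_ac_in_splitting_field: "to_ac x \<in> splitting_field (f3 a)"
  unfolding splitting_field_def by (auto intro: generate_field.incl)

lemma splitting_field_subset:
  fixes a :: "'m::field \<times> 'm \<times> 'm"
  assumes "(3 :: 'm) \<noteq> 0"
    and "is_subfield K" "range to_ac \<subseteq> K" "depressed_roots a \<subseteq> K"
  shows "splitting_field (f3 a) \<subseteq> K"
  unfolding splitting_field_f3[OF assms(1)] using assms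
  by (intro field.generate_field_min_subfield1[OF field_from_type_algebra])
    (auto simp: ring_of_type_algebra_simps)

section \<open>Transforms give equal splitting fields\<close>

lemma splitting_field_subset_of_transform:
  fixes a b :: "'m::field \<times> 'm \<times> 'm"
  assumes three: "(3 :: 'm) \<noteq> 0"
    and AB: "A3 b = tschirn_A (A3 a) (B3 a) v w" "B3 b = tschirn_B (A3 a) (B3 a) v w"
    and d: "v ^ 3 - 3 * A3 a * v * w ^ 2 - B3 a * w ^ 3 \<noteq> 0"
  shows "splitting_field (f3 a) \<subseteq> splitting_field (f3 b)"
proof (rule splitting_field_subset[OF three])
  note closed = subfield_closed[OF is_subfield_splitting_field]
  show "depressed_roots a \<subseteq> splitting_field (f3 b)"
  proof
    fix x assume x: "x \<in> depressed_roots a"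
    let ?A = "to_ac (A3 a)" and ?B = "to_ac (B3 a)" and ?v = "to_ac v" and ?w = "to_ac w"
    define y where "y = ?v * x + ?w * (x ^ 2 - 2 * ?A)"
    have AB_ac: "to_ac (A3 b) = tschirn_A ?A ?B ?v ?w" "to_ac (B3 b) = tschirn_B ?A ?B ?v ?w"
      unfolding AB tschirn_A_def tschirn_B_def by simp_all
    have "y \<in> depressed_roots b"
      using transform_root[OF _ y_def, of ?B] x AB_ac by simp
    then have y: "y \<in> splitting_field (f3 b)"
      using depressed_roots_subset_splitting_field[OF three] by blast
    define d where "d = v ^ 3 - 3 * A3 a * v * w ^ 2 - B3 a * w ^ 3"
    have "(to_ac (v ^ 2 - A3 a * w ^ 2) * y - ?w * (y ^ 2 - 2 * to_ac (A3 b))) = to_ac d * x"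
      using transform_inverse[OF _ y_def, of ?B] x AB_ac unfolding d_def by simp
    then have "x = (to_ac (v ^ 2 - A3 a * w ^ 2) * y - ?w * (y ^ 2 - 2 * to_ac (A3 b))) / to_ac d"
      using d unfolding d_def[symmetric] by simp
    also have "\<dots> \<in> splitting_field (f3 b)"
      by (intro closed y to_ac_in_splitting_field)
    finally show "x \<in> splitting_field (f3 b)" .
  qed
  show "range to_ac \<subseteq> splitting_field (f3 b)" using to_ac_in_splitting_field by blast
qed (rule is_subfield_splitting_field)

lemma transform_det_nonzero:
  fixes b :: "'m::field \<times> 'm \<times> 'm"
  assumes three: "(3 :: 'm) \<noteq> 0"
    and AB: "A3 b = tschirn_A A B v w" "B3 b = tschirn_B A B v w"
    and D: "D3 b \<noteq> 0"
  shows "v ^ 3 - 3 * A * v * w ^ 2 - B * w ^ 3 \<noteq> 0"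
proof
  assume "v ^ 3 - 3 * A * v * w ^ 2 - B * w ^ 3 = 0"
  then have "27 * D3 b = 0"
    using A3_B3_D3[of b] tschirn_discriminant[OF refl, of A B v w] unfolding AB by simp
  then show False using twenty_seven_nonzero[OF three] D by simp
qed

lemma splitting_field_eq_of_transform:
  fixes a b :: "'m::field \<times> 'm \<times> 'm"
  assumes three: "(3 :: 'm) \<noteq> 0"
    and A: "A3 b = tschirn_A (A3 a) (B3 a) v w" and B: "B3 b = tschirn_B (A3 a) (B3 a) v w"
    and D: "D3 a \<noteq> 0" "D3 b \<noteq> 0"
  shows "splitting_field (f3 a) = splitting_field (f3 b)"
proof -
  define d where "d = v ^ 3 - 3 * A3 a * v * w ^ 2 - B3 a * w ^ 3"
  \<comment> \<open>The coefficients from \<open>tschirn_inverse\<close>, divided by the determinant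
    \<open>d\<close>.\<close>
  define v' w' where "v' = (v ^ 2 - A3 a * w ^ 2) / d" and "w' = - w / d"
  have d: "d \<noteq> 0" using transform_det_nonzero[OF three A B] D unfolding d_def by simp
  have "tschirn_A (A3 b) (B3 b) v' w' = tschirn_A (A3 b) (B3 b) (v ^ 2 - A3 a * w ^ 2) (- w) / d ^ 2"
    unfolding v'_def w'_def by (rule tschirn_A_divide)
  then have A': "A3 a = tschirn_A (A3 b) (B3 b) v' w'"
    using d unfolding A B tschirn_inverse(1)[OF d_def] by simp
  have "tschirn_B (A3 b) (B3 b) v' w' = tschirn_B (A3 b) (B3 b) (v ^ 2 - A3 a * w ^ 2) (- w) / d ^ 3"
    unfolding v'_def w'_def by (rule tschirn_B_divide)
  then have B': "B3 a = tschirn_B (A3 b) (B3 b) v' w'"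
    using d unfolding A B tschirn_inverse(2)[OF d_def] by simp
  show ?thesis
    using splitting_field_subset_of_transform[OF three A B transform_det_nonzero[OF three A B D(2)]]
      splitting_field_subset_of_transform[OF three A' B' transform_det_nonzero[OF three A' B' D(1)]]
    by (rule antisym)
qed

section \<open>Equal splitting fields give a transform\<close>

lemma depressed_roots_nonempty: "depressed_roots a \<noteq> {}"
proof -
  obtain x where "poly [:- to_ac (B3 a), - (3 * to_ac (A3 a)), 0, 1:] x = 0"
    using alg_closed_imp_poly_has_root[of "[:- to_ac (B3 a), - (3 * to_ac (A3 a)), 0, 1:]"] by auto
  then have "x ^ 3 - (3 * to_ac (A3 a) * x + to_ac (B3 a)) = 0"
    by (simp add: algebra_simps power3_eq_cube)
  then show ?thesis by auto
qed

text \<open>Dividing the cubic by \<open>X - x\<close> leaves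
  \<open>X ^ 2 + x * X + x ^ 2 - 3 * A3 a\<close>, whose roots are \<open>t\<close> and
  \<open>- x - t\<close>.\<close>

lemma splitting_field_subset_quadratic_extension:
  fixes a :: "'m::field \<times> 'm \<times> 'm"
  assumes three: "(3 :: 'm) \<noteq> 0"
    and K: "is_subfield K" "range to_ac \<subseteq> K" and x: "x \<in> K" "x \<in> depressed_roots a"
  obtains r s t where "r \<in> K" "s \<in> K" "t ^ 2 = r * t + s"
    "splitting_field (f3 a) \<subseteq> {p + q * t | p q. p \<in> K \<and> q \<in> K}"
proof -
  note closed = subfield_closed[OF K(1)]
  let ?A = "to_ac (A3 a)" and ?B = "to_ac (B3 a)"
  obtain t where "poly [:x ^ 2 - 3 * ?A, x, 1:] t = 0"
    using alg_closed_imp_poly_has_root[of "[:x ^ 2 - 3 * ?A, x, 1:]"] by auto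
  then have t0: "t ^ 2 + x * t + x ^ 2 - 3 * ?A = 0"
    by (simp add: algebra_simps power2_eq_square)
  have t: "t ^ 2 = (- x) * t + (3 * ?A - x ^ 2)"
  proof -
    have "t ^ 2 = (t ^ 2 + x * t + x ^ 2 - 3 * ?A) + ((- x) * t + (3 * ?A - x ^ 2))"
      by simp
    then show ?thesis unfolding t0 by simp
  qed
  have rs: "- x \<in> K" "3 * ?A - x ^ 2 \<in> K" using x K(2) by (auto intro!: closed)
  let ?L = "{p + q * t | p q. p \<in> K \<and> q \<in> K}"
  have L: "is_subfield ?L" by (rule is_subfield_quadratic_extension[OF K(1) rs t])
  have mem: "p + q * t \<in> ?L" if "p \<in> K" "q \<in> K" for p q using that by blast
  have "K \<subseteq> ?L" using mem[OF _ closed(1)] by auto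
  moreover have "depressed_roots a \<subseteq> ?L"
  proof
    fix z assume "z \<in> depressed_roots a"
    then have z: "z ^ 3 = 3 * ?A * z + ?B" by simp
    have "(z - x) * ((z - t) * (z + x + t)) =
        (z ^ 3 - (3 * ?A * z + ?B)) - (x ^ 3 - (3 * ?A * x + ?B))
        - (z - x) * (t ^ 2 + x * t + x ^ 2 - 3 * ?A)"
      by (simp add: algebra_simps power2_eq_square power3_eq_cube)
    also have "\<dots> = 0" using z x t0 by simp
    finally consider "z - x = 0" | "z - t = 0" | "z + x + t = 0"
      unfolding mult_eq_0_iff by blast
    then show "z \<in> ?L"
    proof cases
      case 1
      then show ?thesis using \<open>K \<subseteq> ?L\<close> x(1) by auto
    next
      case 2
      then show ?thesis using mem[OF closed(1,2)] by simp
    next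
      case 3
      have "z = (z + x + t) - x - t" by simp
      then have "z = - x - t" unfolding 3 by simp
      then show ?thesis using mem[of "- x" "- 1"] rs closed(2,3) by simp
    qed
  qed
  ultimately have "splitting_field (f3 a) \<subseteq> ?L"
    using splitting_field_subset[OF three L] K(2) by blast
  then show thesis using that rs t by blast
qed

text \<open>The common splitting field lies in a quadratic extension of the cubic field \<open>K\<close> generated by a
  root \<open>x\<close> for \<open>a\<close>. It contains a root for \<open>b\<close>, so \<open>K\<close> itself contains one, which is the required
  transform of \<open>x\<close>.\<close>

lemma transform_of_splitting_field_eq:
  fixes a b :: "'m::field \<times> 'm \<times> 'm"
  assumes three: "(3 :: 'm) \<noteq> 0"
    and no_root: "\<And>c. c ^ 3 \<noteq> 3 * A3 a * c + B3 a"
    and eq: "splitting_field (f3 a) = splitting_field (f3 b)"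
  obtains v w where "A3 b = tschirn_A (A3 a) (B3 a) v w" "B3 b = tschirn_B (A3 a) (B3 a) v w"
proof -
  let ?F = "range (to_ac :: 'm \<Rightarrow> _)"
  let ?A = "to_ac (A3 a)" and ?B = "to_ac (B3 a)"
  let ?A' = "to_ac (A3 b)" and ?B' = "to_ac (B3 b)"
  note F = is_subfield_range_to_ac[where 'a = 'm]
  have no_root_a: "c ^ 3 \<noteq> 3 * ?A * c + ?B" if "c \<in> ?F" for c
  proof -
    obtain d where "c = to_ac d" using \<open>c \<in> ?F\<close> by blast
    moreover have "to_ac (d ^ 3) \<noteq> to_ac (3 * A3 a * d + B3 a)"
      using no_root[of d] unfolding to_ac_eq_iff .
    ultimately show ?thesis by simp
  qed
  obtain x where x: "x \<in> depressed_roots a" using depressed_roots_nonempty by blast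
  \<comment> \<open>A ground field root for \<open>b\<close> would put the common splitting field,
    and with it \<open>x\<close>, into a quadratic extension; then \<open>a\<close> would have a
    root in the ground field too.\<close>
  have no_root_b: "c ^ 3 \<noteq> 3 * ?A' * c + ?B'" if "c \<in> ?F" for c
  proof
    assume "c ^ 3 = 3 * ?A' * c + ?B'"
    then have "c \<in> depressed_roots b" by simp
    from splitting_field_subset_quadratic_extension[OF three F subset_refl \<open>c \<in> ?F\<close> this]
    obtain r s t where rst: "r \<in> ?F" "s \<in> ?F" "t ^ 2 = r * t + s"
      "splitting_field (f3 b) \<subseteq> {p + q * t | p q. p \<in> ?F \<and> q \<in> ?F}" .
    have x_mem: "x \<in> {p + q * t | p q. p \<in> ?F \<and> q \<in> ?F}"
      by (rule subsetD[OF rst(4)])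
        (use subsetD[OF depressed_roots_subset_splitting_field[OF three] x] eq in simp)
    have x': "x ^ 3 = 3 * ?A * x + ?B" using x by simp
    from cubic_root_in_quadratic_extension[OF F rangeI rangeI rst(1,2) x' rst(3) x_mem]
    have "\<exists>c\<in>?F. c ^ 3 = 3 * ?A * c + ?B" .
    then show False using no_root_a by blast
  qed
  define K where "K = {c + v * x + w * (x ^ 2 - 2 * ?A) | c v w. c \<in> ?F \<and> v \<in> ?F \<and> w \<in> ?F}"
  have K: "is_subfield K"
    unfolding K_def by (rule is_subfield_cubic_extension[OF F, of ?A ?B x]) (use x in auto)
  have mem: "c + v * x + w * (x ^ 2 - 2 * ?A) \<in> K" if "c \<in> ?F" "v \<in> ?F" "w \<in> ?F" for c v w
    using that unfolding K_def by blast
  have FK: "?F \<subseteq> K" using mem[OF _ subfield_0[OF F] subfield_0[OF F]] by auto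
  have xK: "x \<in> K" using mem[OF subfield_0[OF F] subfield_1[OF F] subfield_0[OF F]] by simp
  obtain r s t where rst: "r \<in> K" "s \<in> K" "t ^ 2 = r * t + s"
    "splitting_field (f3 a) \<subseteq> {p + q * t | p q. p \<in> K \<and> q \<in> K}"
    by (rule splitting_field_subset_quadratic_extension[OF three K FK xK x])
  obtain y0 where y0: "y0 \<in> depressed_roots b" using depressed_roots_nonempty by blast
  have y0': "y0 ^ 3 = 3 * ?A' * y0 + ?B'" using y0 by simp
  have y0_mem: "y0 \<in> {p + q * t | p q. p \<in> K \<and> q \<in> K}"
    by (rule subsetD[OF rst(4)])
      (use subsetD[OF depressed_roots_subset_splitting_field[OF three] y0] eq in simp)
  have "?A' \<in> K" "?B' \<in> K" using FK by blast+
  from cubic_root_in_quadratic_extension[OF K this rst(1,2) y0' rst(3) y0_mem]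
  obtain y where y: "y \<in> K" "y ^ 3 = 3 * ?A' * y + ?B'" by blast
  from y(1) obtain c v w where
    cvw: "y = to_ac c + to_ac v * x + to_ac w * (x ^ 2 - 2 * ?A)" unfolding K_def by blast
  let ?Q = "tschirn_A (A3 a) (B3 a) v w" and ?C = "tschirn_B (A3 a) (B3 a) v w"
  have "(y - to_ac c) ^ 3 = 3 * to_ac ?Q * (y - to_ac c) + to_ac ?C"
    using transform_root[of x ?A ?B "y - to_ac c" "to_ac v" "to_ac w"] x cvw
    unfolding tschirn_A_def tschirn_B_def by simp
  \<comment> \<open>Subtracting the cubic equation of \<open>y\<close> cancels \<open>y ^ 3\<close>;
    by independence of \<open>1, y, y ^ 2\<close> the remaining coefficients vanish, so
    \<open>c = 0\<close> and the invariants agree.\<close>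
  then have "to_ac (B3 b - c ^ 3 + 3 * ?Q * c - ?C) + to_ac (3 * A3 b + 3 * c ^ 2 - 3 * ?Q) * y
      + to_ac (- 3 * c) * y ^ 2 = 0"
    using y(2) by (simp add: algebra_simps power2_eq_square power3_eq_cube)
  from irreducible_cubic_root_independent
    [OF F rangeI rangeI no_root_b y(2) rangeI rangeI rangeI this]
  have "to_ac (B3 b - c ^ 3 + 3 * ?Q * c - ?C) = 0 \<and> to_ac (3 * A3 b + 3 * c ^ 2 - 3 * ?Q) = 0
      \<and> to_ac (- 3 * c) = 0" .
  then have "B3 b - c ^ 3 + 3 * ?Q * c - ?C = 0" "3 * A3 b + 3 * c ^ 2 - 3 * ?Q = 0" "- 3 * c = 0"
    by (simp_all only: to_ac_eq_0_iff)
  then have "B3 b = ?C" "3 * (A3 b - ?Q) = 0" using three by (auto simp: algebra_simps)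
  then show thesis using that three by simp
qed
section \<open>Roots of the sextic\<close>

text \<open>\<open>F2\<close> cleared of its denominator \<open>D3 a ^ 3\<close>; the primed variables are the invariants of \<open>b\<close>.\<close>

definition F2_num :: "'a::field \<Rightarrow> 'a \<Rightarrow> 'a \<Rightarrow> 'a \<Rightarrow> 'a \<Rightarrow> 'a \<Rightarrow> 'a" where
  "F2_num A D A' B' D' u = D ^ 3 * u ^ 6 - 2 * A * A' * D ^ 2 * u ^ 4 + B' * D ^ 2 * u ^ 3
    + A ^ 2 * A' ^ 2 * D * u ^ 2 - A * A' * B' * D * u + (A' ^ 3 * D - A ^ 3 * D')"

lemma poly_F2_eq_0_iff:
  assumes "D3 a \<noteq> 0"
  shows "poly (F2 a b) u = 0 \<longleftrightarrow> F2_num (A3 a) (D3 a) (A3 b) (B3 b) (D3 b) u = 0"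
proof -
  have "poly (F2 a b) u = F2_num (A3 a) (D3 a) (A3 b) (B3 b) (D3 b) u / D3 a ^ 3"
    unfolding F2_def F2_num_def using assms
    by (simp add: field_simps eval_nat_numeral)
  then show ?thesis using assms by simp
qed

text \<open>With \<open>27 * D = 4 * A ^ 3 - B ^ 2\<close> the transformed cubic has
  \<open>D' = D * (v ^ 3 - 3 * A * v * w ^ 2 - B * w ^ 3) ^ 2\<close>.\<close>

lemma F2_num_transform:
  fixes A :: "'a::field"
  assumes D: "27 * D = 4 * A ^ 3 - B ^ 2"
    and D': "27 * D' = 4 * tschirn_A A B v w ^ 3 - tschirn_B A B v w ^ 2"
    and three: "(3 :: 'a) \<noteq> 0"
  shows "F2_num A D (tschirn_A A B v w) (tschirn_B A B v w) D' (3 * w) = 0"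
proof -
  define d where "d = v ^ 3 - 3 * A * v * w ^ 2 - B * w ^ 3"
  note 27 = twenty_seven_nonzero[OF three]
  have "27 * D' = 27 * (D * d ^ 2)"
    unfolding D' tschirn_discriminant[OF d_def] D[symmetric] by simp
  then have D'_eq: "D' = D * d ^ 2" using 27 mult_left_cancel by blast
  define Q C where "Q = tschirn_A A B v w" and "C = tschirn_B A B v w"
  define t where "t = (A ^ 3 - B ^ 2) * w ^ 3 - 3 * A ^ 2 * v ^ 2 * w - 3 * A * B * v * w ^ 2"
  have t: "(27 * D) * w ^ 3 - 3 * A * Q * w = t"
    unfolding D t_def Q_def tschirn_A_def by (simp add: algebra_simps eval_nat_numeral)
  \<comment> \<open>The bracket is \<open>t ^ 2 + C * t + Q ^ 3 - A ^ 3 * d ^ 2\<close>, which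
    vanishes by the syzygy, as \<open>C = B * d - 2 * t\<close>.\<close>
  have "F2_num A D Q C D' (3 * w) = D * (((27 * D) * w ^ 3 - 3 * A * Q * w) ^ 2
      + C * ((27 * D) * w ^ 3 - 3 * A * Q * w) + Q ^ 3 - A ^ 3 * d ^ 2)"
    unfolding F2_num_def D'_eq by (simp add: algebra_simps eval_nat_numeral)
  also have "\<dots> = 0"
    unfolding t unfolding C_def Q_def tschirn_syzygy[OF d_def t_def]
    by (simp add: algebra_simps power2_eq_square)
  finally show ?thesis unfolding Q_def C_def .
qed

text \<open>Modulo \<open>tschirn_A A B v w - A'\<close>, the expression \<open>A ^ 2 * (tschirn_B A B v w - B')\<close> is linear in \<open>v\<close>.
  Solving the linear equation for \<open>v\<close> and substituting into \<open>tschirn_A A B v w = A'\<close> leaves a multiple of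
  \<open>F2_num\<close>.\<close>

lemma tschirn_B_mod_tschirn_A:
  assumes D: "27 * D = 4 * A ^ 3 - B ^ 2"
  shows "A ^ 2 * (tschirn_B A B v w - B') = B * (A * A' - 27 * D * w ^ 2) * v
      + (w * A' * (2 * A ^ 3 + 27 * D) - 54 * A ^ 2 * D * w ^ 3 - A ^ 2 * B')
      + (A * B * v + 6 * A ^ 3 * w - B ^ 2 * w) * (tschirn_A A B v w - A')"
proof -
  have "54 * A ^ 2 * D * w ^ 3 = 2 * A ^ 2 * (27 * D) * w ^ 3" by simp
  then show ?thesis unfolding D tschirn_A_def tschirn_B_def
    by (simp only: D) (simp add: algebra_simps eval_nat_numeral)
qed

text \<open>The left side is the resultant in \<open>v\<close> of
  \<open>tschirn_A A B v w - A'\<close> and \<open>B * l * v + m\<close>. It involves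
  \<open>B\<close> only through \<open>B ^ 2\<close>, which \<open>D\<close> eliminates.\<close>

lemma F2_num_resultant:
  fixes A :: "'a::field"
  assumes D: "27 * D = 4 * A ^ 3 - B ^ 2" and D': "27 * D' = 4 * A' ^ 3 - B' ^ 2"
    and l: "l = A * A' - 27 * D * w ^ 2"
    and m: "m = w * A' * (2 * A ^ 3 + 27 * D) - 54 * A ^ 2 * D * w ^ 3 - A ^ 2 * B'"
  shows "A * m ^ 2 - B * m * (B * l) * w + (A ^ 2 * w ^ 2 - A') * (B * l) ^ 2
    = 27 * A ^ 2 * F2_num A D A' B' D' (3 * w)"
proof -
  have B: "B ^ 2 = 4 * A ^ 3 - 27 * D" using D by simp
  have "A * m ^ 2 - B * m * (B * l) * w + (A ^ 2 * w ^ 2 - A') * (B * l) ^ 2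
     = A * m ^ 2 + B ^ 2 * ((A ^ 2 * w ^ 2 - A') * l ^ 2 - m * l * w)"
    by (simp add: algebra_simps power2_eq_square)
  also have "\<dots> = 27 * A ^ 2 * (D ^ 3 * (3 * w) ^ 6 - 2 * A * A' * D ^ 2 * (3 * w) ^ 4
      + B' * D ^ 2 * (3 * w) ^ 3 + A ^ 2 * A' ^ 2 * D * (3 * w) ^ 2 - A * A' * B' * D * (3 * w)
      + A' ^ 3 * D) - A ^ 5 * (4 * A' ^ 3 - B' ^ 2)"
    unfolding B l m by (simp add: algebra_simps eval_nat_numeral)
  also have "\<dots> = 27 * A ^ 2 * F2_num A D A' B' D' (3 * w)"
    unfolding D'[symmetric] F2_num_def by (simp add: algebra_simps eval_nat_numeral)
  finally show ?thesis .
qed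

text \<open>The case \<open>A * A' = 3 * D * u ^ 2\<close>, in which the linear equation degenerates, is the case of a
  multiple root \<open>u\<close>.\<close>

lemma F2_num_multiple_root:
  fixes A :: "'a::field"
  assumes D': "27 * D' = 4 * A' ^ 3 - B' ^ 2" and "D \<noteq> 0"
    and u: "A * A' = 3 * D * u ^ 2" and F: "F2_num A D A' B' D' u = 0"
  shows "A ^ 3 * B' ^ 2 - 27 * A' ^ 3 * D = 0"
proof -
  define p where "p = A * A'"
  have "F2_num A D A' B' D' u = D ^ 3 * u ^ 6 - 2 * p * D ^ 2 * u ^ 4 + B' * D ^ 2 * u ^ 3
    + p ^ 2 * D * u ^ 2 - p * B' * D * u + (A' ^ 3 * D - A ^ 3 * D')"
    unfolding F2_num_def p_def by (simp add: algebra_simps power2_eq_square)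
  also have "\<dots> = 4 * D ^ 3 * u ^ 6 - 2 * B' * D ^ 2 * u ^ 3 + (A' ^ 3 * D - A ^ 3 * D')"
    unfolding p_def u by (simp add: algebra_simps eval_nat_numeral)
  finally have "4 * D ^ 3 * u ^ 6 + (A' ^ 3 * D - A ^ 3 * D') = 2 * B' * D ^ 2 * u ^ 3"
    unfolding F by (simp add: algebra_simps)
  then have "27 * (4 * D ^ 3 * u ^ 6 + (A' ^ 3 * D - A ^ 3 * D')) = 27 * (2 * B' * D ^ 2 * u ^ 3)"
    by (rule arg_cong)
  moreover have "27 * (4 * D ^ 3 * u ^ 6 + (A' ^ 3 * D - A ^ 3 * D'))
      = 4 * (3 * D * u ^ 2) ^ 3 + 27 * A' ^ 3 * D - A ^ 3 * (27 * D')"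
    by (simp add: algebra_simps eval_nat_numeral)
  then have "27 * (4 * D ^ 3 * u ^ 6 + (A' ^ 3 * D - A ^ 3 * D')) = 27 * A' ^ 3 * D + A ^ 3 * B' ^ 2"
    unfolding D' u[symmetric] by (simp add: algebra_simps eval_nat_numeral)
  \<comment> \<open>After squaring, \<open>u\<close> occurs only through \<open>u ^ 2\<close> and
    can be eliminated. For the two summands \<open>P\<close>, \<open>R\<close> this gives
    \<open>(P + R) ^ 2 = 4 * P * R\<close>, so \<open>P = R\<close>.\<close>
  ultimately have "(27 * A' ^ 3 * D + A ^ 3 * B' ^ 2) ^ 2 = (27 * (2 * B' * D ^ 2 * u ^ 3)) ^ 2"
    by simp
  also have "\<dots> = 108 * B' ^ 2 * D * (3 * D * u ^ 2) ^ 3"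
    by (simp add: algebra_simps eval_nat_numeral)
  also have "\<dots> = 4 * (27 * A' ^ 3 * D) * (A ^ 3 * B' ^ 2)"
    unfolding u[symmetric] by (simp add: algebra_simps eval_nat_numeral)
  finally have "(A ^ 3 * B' ^ 2 - 27 * A' ^ 3 * D) ^ 2 = 0"
    by (simp add: power2_eq_square algebra_simps)
  then show ?thesis by simp
qed

text \<open>\<open>v\<close> solves \<open>B * l * v + m = 0\<close>, where
  \<open>l = A * A' - 3 * D * u ^ 2\<close> is nonzero by \<open>nondeg\<close>; the vanishing
  resultant makes it solve the quadratic equation as well.\<close>

lemma transform_of_F2_num_root:
  fixes A :: "'a::field"
  assumes three: "(3 :: 'a) \<noteq> 0"
    and D: "27 * D = 4 * A ^ 3 - B ^ 2" "D \<noteq> 0" and D': "27 * D' = 4 * A' ^ 3 - B' ^ 2"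
    and A: "A \<noteq> 0" and B: "B \<noteq> 0" and nondeg: "A ^ 3 * B' ^ 2 - 27 * A' ^ 3 * D \<noteq> 0"
    and u: "F2_num A D A' B' D' u = 0"
  obtains v w where "A' = tschirn_A A B v w" "B' = tschirn_B A B v w"
proof -
  define w where "w = u / 3"
  have uw: "u = 3 * w" unfolding w_def using three by simp
  define l where "l = A * A' - 27 * D * w ^ 2"
  define m where "m = w * A' * (2 * A ^ 3 + 27 * D) - 54 * A ^ 2 * D * w ^ 3 - A ^ 2 * B'"
  have l: "l \<noteq> 0"
    using F2_num_multiple_root[OF D' D(2) _ u] nondeg unfolding l_def uw by auto
  define v where "v = - m / (B * l)"
  have v: "B * l * v = - m" unfolding v_def using B l by simp
  have "(B * l) ^ 2 * (tschirn_A A B v w - A') = A * (B * l * v) ^ 2 + B * (B * l * v) * (B * l) * w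
      + (A ^ 2 * w ^ 2 - A') * (B * l) ^ 2"
    unfolding tschirn_A_def by (simp add: algebra_simps power2_eq_square)
  also have "\<dots> = A * m ^ 2 - B * m * (B * l) * w + (A ^ 2 * w ^ 2 - A') * (B * l) ^ 2"
    unfolding v by simp
  also have "\<dots> = 0"
    unfolding F2_num_resultant[OF D(1) D' l_def m_def] using u uw by simp
  finally have A': "tschirn_A A B v w = A'" using B l by simp
  have "A ^ 2 * (tschirn_B A B v w - B') = B * l * v + m"
    using tschirn_B_mod_tschirn_A[OF D(1), of v w B' A'] unfolding A' l_def m_def by simp
  then have "tschirn_B A B v w = B'" using v A by simp
  with A' show thesis using that by metis
qed

text \<open>The degenerate case: here \<open>3 * w\<close> is the simple root of the cubic factor of \<open>F2\<close> that has a
  double root, and \<open>2 * A * v + B * w = 0\<close>, so the derivative of \<open>tschirn_A\<close> in \<open>v\<close> vanishes.\<close>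

lemma transform_of_degenerate:
  fixes A :: "'a::field"
  assumes three: "(3 :: 'a) \<noteq> 0"
    and D: "27 * D = 4 * A ^ 3 - B ^ 2" "D \<noteq> 0" and A: "A \<noteq> 0" "A' \<noteq> 0"
    and deg: "A ^ 3 * B' ^ 2 = 27 * A' ^ 3 * D"
  obtains v w where "A' = tschirn_A A B v w" "B' = tschirn_B A B v w"
proof -
  note 27 = twenty_seven_nonzero[OF three]
  \<comment> \<open>On the line \<open>v = A * B * k\<close>, \<open>w = - 2 * A ^ 2 * k\<close> one
    has \<open>tschirn_B A B v w = 27 * D * k * tschirn_A A B v w\<close>, which dictates
    \<open>k\<close>.\<close>
  define k where "k = B' / (27 * A' * D)"
  have B': "B' = 27 * D * A' * k" unfolding k_def using 27 D(2) A by simp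
  have "27 * D * A' ^ 2 * (27 * D * A ^ 3 * k ^ 2) = 27 * D * A' ^ 2 * A'"
    using deg unfolding B' by (simp add: algebra_simps eval_nat_numeral)
  moreover have "27 * D * A' ^ 2 \<noteq> 0" using 27 D(2) A(2) by simp
  ultimately have A': "27 * D * A ^ 3 * k ^ 2 = A'" using mult_left_cancel by blast
  have "tschirn_A A B (A * B * k) (- 2 * A ^ 2 * k) = A ^ 3 * k ^ 2 * (4 * A ^ 3 - B ^ 2)"
    unfolding tschirn_A_def by (simp add: algebra_simps eval_nat_numeral)
  then have 1: "tschirn_A A B (A * B * k) (- 2 * A ^ 2 * k) = A'"
    unfolding D(1)[symmetric] A'[symmetric] by (simp add: algebra_simps)
  have "tschirn_B A B (A * B * k) (- 2 * A ^ 2 * k) = A ^ 3 * k ^ 3 * (4 * A ^ 3 - B ^ 2) ^ 2"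
    unfolding tschirn_B_def by (simp add: algebra_simps eval_nat_numeral)
  also have "\<dots> = 27 * D * (27 * D * A ^ 3 * k ^ 2) * k"
    unfolding D(1)[symmetric] by (simp add: algebra_simps eval_nat_numeral)
  also have "\<dots> = B'" unfolding A' B' by simp
  finally show thesis using 1 that by metis
qed

section \<open>Consequences of the hypotheses, and the theorem\<close>

lemma three_nonzero_of_ring_hom:
  fixes \<iota> :: "'k::field \<Rightarrow> 'm::field"
  assumes "CHAR('k) \<noteq> 3" and \<iota>: "\<iota> \<in> ring_hom ring_of_type_algebra ring_of_type_algebra"
  shows "(3 :: 'm) \<noteq> 0"
proof
  have add: "\<iota> (x + y) = \<iota> x + \<iota> y" and mult: "\<iota> (x * y) = \<iota> x * \<iota> y" and one: "\<iota> 1 = 1" for x y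
    using ring_hom_add[OF \<iota>, of x y] ring_hom_mult[OF \<iota>, of x y] ring_hom_one[OF \<iota>]
    by (simp_all add: ring_of_type_algebra_simps)
  have "\<not> CHAR('k) dvd 3"
  proof
    assume "CHAR('k) dvd 3"
    moreover have "prime (3 :: nat)" by simp
    ultimately have "CHAR('k) = 1 \<or> CHAR('k) = 3" unfolding prime_nat_iff by blast
    then show False using assms(1) by simp
  qed
  then have "(3 :: 'k) \<noteq> 0"
    using of_nat_eq_0_iff_char_dvd[of 3, where 'a = 'k] by simp
  \<comment> \<open>A ring homomorphism maps the unit \<open>3\<close> of \<open>'k\<close> to a
    unit.\<close>
  then have "\<iota> 3 * \<iota> (inverse 3) = 1"
    using mult[of 3 "inverse 3"] one by simp
  moreover have "\<iota> 3 = 3"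
    using add[of 1 1] add[of 2 1] one by simp
  moreover assume "(3 :: 'm) = 0"
  ultimately show False by simp
qed

text \<open>A root \<open>c\<close> of the depressed cubic pulls back to the root
  \<open>(c + a1) / 3\<close>, which splits a linear factor off \<open>f3 a\<close>.\<close>

lemma irreducible_f3_no_root:
  fixes a :: "'m::field \<times> 'm \<times> 'm"
  assumes "(3 :: 'm) \<noteq> 0" "Factorial_Ring.irreducible (f3 a)"
  shows "c ^ 3 \<noteq> 3 * A3 a * c + B3 a"
proof
  assume c: "c ^ 3 = 3 * A3 a * c + B3 a"
  obtain a1 a2 a3 where a: "a = (a1, a2, a3)" by (cases a)
  define x where "x = (c + a1) / 3"
  have "3 * x = c + a1" unfolding x_def using assms(1) by simp
  then have c_eq: "c = 3 * x - a1" by simp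
  have "27 * poly (f3 a) x = c ^ 3 - (3 * A3 a * c + B3 a)"
    unfolding c_eq a by (simp add: algebra_simps eval_nat_numeral)
  then have "poly (f3 a) x = 0" using c twenty_seven_nonzero[OF assms(1)] by simp
  moreover have "degree (f3 a) = 3" unfolding a by simp
  ultimately show False
    using root_imp_reducible_poly[of "f3 a" x] assms(2) by simp
qed

theorem theorem4p3:
  fixes \<iota> :: "'k::field \<Rightarrow> 'm::field"
    and a b :: "'m \<times> 'm \<times> 'm"
  assumes "CHAR('k) \<noteq> 3"
    and "\<iota> \<in> ring_hom ring_of_type_algebra ring_of_type_algebra"
    and "infinite (UNIV :: 'm set)"
    and "D3 a * D3 b \<noteq> 0"
    and "Factorial_Ring.irreducible (f3 a)"
    and "A3 a * A3 b \<noteq> 0"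
  shows "(A3 a ^ 3 * B3 b ^ 2 - 27 * A3 b ^ 3 * D3 a = 0 \<longrightarrow>
            splitting_field (f3 a) = splitting_field (f3 b)) \<and>
         (A3 a ^ 3 * B3 b ^ 2 - 27 * A3 b ^ 3 * D3 a \<noteq> 0 \<longrightarrow>
            (splitting_field (f3 a) = splitting_field (f3 b) \<longleftrightarrow>
             (\<exists>x. poly (F2 a b) x = 0)))"
proof -
  have three: "(3 :: 'm) \<noteq> 0" by (rule three_nonzero_of_ring_hom) fact+
  note no_root = irreducible_f3_no_root[OF three assms(5)]
  have A: "A3 a \<noteq> 0" "A3 b \<noteq> 0" and D: "D3 a \<noteq> 0" "D3 b \<noteq> 0" using assms(4,6) by auto
  \<comment> \<open>Otherwise \<open>0\<close> is a root of the depressed cubic.\<close>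
  have B: "B3 a \<noteq> 0" using no_root[of 0] by auto
  have Da: "27 * D3 a = 4 * A3 a ^ 3 - B3 a ^ 2" and Db: "27 * D3 b = 4 * A3 b ^ 3 - B3 b ^ 2"
    using A3_B3_D3[of a] A3_B3_D3[of b] by simp_all
  show ?thesis
  proof (intro conjI impI iffI)
    assume "A3 a ^ 3 * B3 b ^ 2 - 27 * A3 b ^ 3 * D3 a = 0"
    then have "A3 a ^ 3 * B3 b ^ 2 = 27 * A3 b ^ 3 * D3 a" by simp
    from transform_of_degenerate[OF three Da D(1) A this] obtain v w
      where "A3 b = tschirn_A (A3 a) (B3 a) v w" "B3 b = tschirn_B (A3 a) (B3 a) v w" .
    then show "splitting_field (f3 a) = splitting_field (f3 b)"
      using D by (rule splitting_field_eq_of_transform[OF three])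
  next
    assume nondeg: "A3 a ^ 3 * B3 b ^ 2 - 27 * A3 b ^ 3 * D3 a \<noteq> 0"
    assume "\<exists>u. poly (F2 a b) u = 0"
    then obtain u where "F2_num (A3 a) (D3 a) (A3 b) (B3 b) (D3 b) u = 0"
      using poly_F2_eq_0_iff[OF D(1)] by blast
    from transform_of_F2_num_root[OF three Da D(1) Db A(1) B nondeg this]
    obtain v w where "A3 b = tschirn_A (A3 a) (B3 a) v w" "B3 b = tschirn_B (A3 a) (B3 a) v w" .
    then show "splitting_field (f3 a) = splitting_field (f3 b)"
      using D by (rule splitting_field_eq_of_transform[OF three])
  next
    assume "splitting_field (f3 a) = splitting_field (f3 b)"
    from transform_of_splitting_field_eq[OF three no_root this] obtain v w
      where A': "A3 b = tschirn_A (A3 a) (B3 a) v w" and B': "B3 b = tschirn_B (A3 a) (B3 a) v w" .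
    \<comment> \<open>In \<open>3 * Y - b1 = v * x + w * (x ^ 2 - 2 * A3 a)\<close> with
      \<open>x = 3 * X - a1\<close>, the coefficient of \<open>X ^ 2\<close> in \<open>Y\<close> is
      \<open>9 * w / 3\<close>.\<close>
    have "poly (F2 a b) (3 * w) = 0"
      using F2_num_transform[OF Da Db[unfolded A' B'] three]
      unfolding poly_F2_eq_0_iff[OF D(1)] A' B' .
    then show "\<exists>u. poly (F2 a b) u = 0" ..
  qed
qed

end
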